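(* Let $k\in\mathcal{C}$ be a circle in the plane, let $c\in\mathcal{P}$ be its center, let $\mathcal{K}=\{c\}$ and $r=k$ (one-letter words), and let $\mathcal{U}=\{[a,b]\times\{d\}\;|\;a,b,d\in\mathbb{R},\ a<b\}$ be the system of proper horizontal segments. There exists a straightedge $\mathrm{EC}(\mathcal{U})$ $T$ constructing $\mathcal{K}$ (the center $c$ of $k$) from $r$ (the given circle $k$).
   Context: For a set (alphabet) $A$, $A^*$ is the set of finite words over $A$, including the empty word $\emptyset$. A rooted tree $T=(r,V,E)$ consists of a vertex set $V$, a root $r\in V$ and edges $E\subset V\times V$ such that for every $u\in V$ there is a unique walk from $r$ to $u$; if $(u,v)\in E$ then $v$ is a child of $u$; a leaf is a vertex with no child; a branch is a maximal (finite or infinite) walk; it starts at $r$ and either ends in a leaf or is infinite. $\mathcal{P}=\mathbb{R}^2$ is the set of points, $\mathcal{L}$ the set of lines in $\mathbb{R}^2$, $\mathcal{C}$ the set of circles of positive radius in $\mathbb{R}^2$; elements of $\mathcal{L}\cup\mathcal{C}$ are called curves. For points $a\ne b$, $l(a,b)$ is the line through $a,b$. For points $a$ and $b\neq c$, $k(a,b,c)$ is the circle with center $a$ and radius $|bc|$; moreover $k(a,b,b)=a\in\mathcal{P}$. Let $\mathcal{S}$ be a set of nonempty subsets of $\mathbb{R}^2$ with $(\mathcal{P}\cup\mathcal{L}\cup\mathcal{C})\cap\mathcal{S}=\emptyset$. An $\mathrm{EC}(\mathcal{S})$ (Euclidean construction with $\mathcal{S}$-arbitrary points) is a rooted tree $T=(r,V,E)$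 with $V\subset(\mathcal{P}\cup\mathcal{L}\cup\mathcal{C}\cup\mathcal{S})^*$ and $r\in(\mathcal{P}\cup\mathcal{L}\cup\mathcal{C})^*$, in which the children of each vertex $u=a_1a_2\dots a_m$, $m\ge0$, are determined by exactly one of the following rules (the rule and the choices in it may vary from vertex to vertex); in rules 1–5, $u$ is deterministic, i.e. $m=0$ or $a_m\notin\mathcal{S}$. 1. $u$ is a leaf. 2. $u$ has exactly one child $a_1\dots a_ma_{m+1}$, where $a_{m+1}=l(a_i,a_j)$ for some $1\le i<j\le m$ with $a_i,a_j\in\mathcal{P}$, $a_i\ne a_j$. 3. $u$ has exactly one child $a_1\dots a_ma_{m+1}$, where $a_{m+1}=k(a_i,a_j,a_k)$ for some $1\le i,j,k\le m$ with $a_i,a_j,a_k\in\mathcal{P}$. 4. $u$ has exactly one child $a_1\dots a_ma_{m+1}$, where $a_{m+1}\in\mathcal{P}$ is an intersection point of two curves $a_i\ne a_j$, $1\le i<j\le m$. 5. $u$ has exactly one child $a_1\dots a_ma_{m+1}$, where $a_{m+1}\in\mathcal{S}$. 6. $m\ge1$, $a_m\in\mathcal{S}$ ($u$ is non-deterministic) and the children of $u$ are exactly the words $a_1\dots a_ma_{m+1}$, one for each point $a_{m+1}\in a_m$. $T$ is a straightedge construction if no edge is obtained by rule 3 with $a_j\ne a_k$. $T$ is terminating if all its branches are finite. For $\mathcal{K}\subset(\mathcal{P}\cup\mathcal{L}\cup\mathcal{C})^*$, $T=(r,V,E)$ constructs $\mathcal{K}$ from $r$ if $T$ is a terminating $\mathrm{EC}(\mathcal{S})$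 with root $r$ such that every leaf $a_1\dots a_m$ of $T$ has a final segment $a_ja_{j+1}\dots a_m\in\mathcal{K}$. *)

theory Defs
  imports "HOL-Analysis.Analysis"
begin

section \<open>Rooted trees\<close>

record 'v tree =
  tree_root :: 'v
  verts :: "'v set"
  edges :: "('v \<times> 'v) set"

definition walk :: "'v tree \<Rightarrow> 'v list \<Rightarrow> bool" where
  "walk T p \<longleftrightarrow> p \<noteq> [] \<and> set p \<subseteq> verts T \<and> successively (\<lambda>u v. (u, v) \<in> edges T) p"

definition rooted_tree :: "'v tree \<Rightarrow> bool" where
  "rooted_tree T \<longleftrightarrow>
     tree_root T \<in> verts T \<and> edges T \<subseteq> verts T \<times> verts T \<and>
     (\<forall>u\<in>verts T. \<exists>!p. walk T p \<and> hd p = tree_root T \<and> last p = u)"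

definition children :: "'v tree \<Rightarrow> 'v \<Rightarrow> 'v set" where
  "children T u = {v. (u, v) \<in> edges T}"

definition leaf :: "'v tree \<Rightarrow> 'v \<Rightarrow> bool" where
  "leaf T u \<longleftrightarrow> u \<in> verts T \<and> children T u = {}"

text \<open>A branch is either a finite walk from the root to a leaf or an infinite walk from the root.
  All branches are finite iff there is none of the second kind.\<close>

definition infinite_branch :: "'v tree \<Rightarrow> (nat \<Rightarrow> 'v) \<Rightarrow> bool" where
  "infinite_branch T f \<longleftrightarrow> f 0 = tree_root T \<and> (\<forall>n. (f n, f (Suc n)) \<in> edges T)"

definition terminating :: "'v tree \<Rightarrow> bool" where
  "terminating T \<longleftrightarrow> \<not> (\<exists>f. infinite_branch T f)"

section \<open>Points, lines, circles\<close>

text \<open>The metric on \<^typ>\<open>real \<times> real\<close> is the Euclidean one.\<close>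

type_synonym point = "real \<times> real"

definition line_through :: "point \<Rightarrow> point \<Rightarrow> point set" where
  "line_through a b = affine hull {a, b}"

definition lines :: "point set set" where
  "lines = {line_through a b | a b. a \<noteq> b}"

definition circles :: "point set set" where
  "circles = {sphere c R | c R. 0 < R}"

text \<open>The alphabet. The two constructors keep points apart from sets of points; curves and the
  elements of \<open>\<S>\<close> are both of the form \<open>Fig X\<close>, and are told apart by
  the disjointness required in \<open>admissible\<close>.\<close>

datatype letter = Pt point | Fig "point set"

type_synonym word = "letter list"

definition plc :: "letter set" where
  "plc = range Pt \<union> Fig ` (lines \<union> circles)"

definition compass :: "point \<Rightarrow> point \<Rightarrow> point \<Rightarrow> letter" where
  "compass a b c = (if b = c then Pt a else Fig (sphere a (dist b c)))"

section \<open>Euclidean constructions with arbitrary points\<close>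

definition admissible :: "point set set \<Rightarrow> bool" where
  "admissible \<S> \<longleftrightarrow> {} \<notin> \<S> \<and> (lines \<union> circles) \<inter> \<S> = {}"

definition deterministic :: "point set set \<Rightarrow> word \<Rightarrow> bool" where
  "deterministic \<S> u \<longleftrightarrow> u = [] \<or> last u \<notin> Fig ` \<S>"

text \<open>\<open>ec_rule \<S> u C\<close>: one of the six rules permits \<open>C\<close> as the set of all children of \<open>u\<close>.
  Letters are indexed from 0.\<close>

inductive ec_rule :: "point set set \<Rightarrow> word \<Rightarrow> word set \<Rightarrow> bool" for \<S> where
  rule1: "deterministic \<S> u \<Longrightarrow> ec_rule \<S> u {}"
| rule2: "deterministic \<S> u \<Longrightarrow> i < j \<Longrightarrow> j < length u \<Longrightarrow>
    u ! i = Pt a \<Longrightarrow> u ! j = Pt b \<Longrightarrow> a \<noteq> b \<Longrightarrow>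
    ec_rule \<S> u {u @ [Fig (line_through a b)]}"
| rule3: "deterministic \<S> u \<Longrightarrow> i < length u \<Longrightarrow> j < length u \<Longrightarrow> l < length u \<Longrightarrow>
    u ! i = Pt a \<Longrightarrow> u ! j = Pt b \<Longrightarrow> u ! l = Pt c \<Longrightarrow>
    ec_rule \<S> u {u @ [compass a b c]}"
| rule4: "deterministic \<S> u \<Longrightarrow> i < j \<Longrightarrow> j < length u \<Longrightarrow>
    u ! i = Fig X \<Longrightarrow> u ! j = Fig Y \<Longrightarrow> X \<in> lines \<union> circles \<Longrightarrow> Y \<in> lines \<union> circles \<Longrightarrow>
    X \<noteq> Y \<Longrightarrow> a \<in> X \<inter> Y \<Longrightarrow>
    ec_rule \<S> u {u @ [Pt a]}"
| rule5: "deterministic \<S> u \<Longrightarrow> X \<in> \<S> \<Longrightarrow> ec_rule \<S> u {u @ [Fig X]}"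
| rule6: "u \<noteq> [] \<Longrightarrow> last u = Fig X \<Longrightarrow> X \<in> \<S> \<Longrightarrow>
    ec_rule \<S> u {u @ [Pt a] | a. a \<in> X}"

definition EC :: "point set set \<Rightarrow> word tree \<Rightarrow> bool" where
  "EC \<S> T \<longleftrightarrow>
     admissible \<S> \<and> rooted_tree T \<and>
     verts T \<subseteq> lists (plc \<union> Fig ` \<S>) \<and> tree_root T \<in> lists plc \<and>
     (\<forall>u\<in>verts T. ec_rule \<S> u (children T u))"

text \<open>If \<open>b \<noteq> c\<close> then \<open>compass a b c\<close> is a circle. In an \<open>EC \<S>\<close> only rule 3 appends a circle, as
  \<open>\<S>\<close> contains none, so the edges below are exactly those obtained by rule 3 with
  distinct second and third point, whatever rule is chosen where several apply.\<close>

definition straightedge :: "word tree \<Rightarrow> bool" where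
  "straightedge T \<longleftrightarrow>
     \<not> (\<exists>u v i j l a b c. (u, v) \<in> edges T \<and>
          i < length u \<and> j < length u \<and> l < length u \<and>
          u ! i = Pt a \<and> u ! j = Pt b \<and> u ! l = Pt c \<and> b \<noteq> c \<and>
          v = u @ [compass a b c])"

definition constructs :: "point set set \<Rightarrow> word tree \<Rightarrow> word set \<Rightarrow> word \<Rightarrow> bool" where
  "constructs \<S> T \<K> r \<longleftrightarrow>
     \<K> \<subseteq> lists plc \<and> EC \<S> T \<and> terminating T \<and> tree_root T = r \<and>
     (\<forall>u. leaf T u \<longrightarrow> (\<exists>j<length u. drop j u \<in> \<K>))"

definition horizontal_segments :: "point set set" where
  "horizontal_segments = {{a..b} \<times> {d} | a b d. a < b}"

end

theory Submission
  imports Defs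
begin

text \<open>Two points picked from disjoint segments of the same height \<open>d\<close> span the line \<open>y = d\<close>, whatever the
  picks are. So every horizontal line can be drawn, in particular the two horizontal tangents of the
  circle and the horizontal line through its center. The tangents touch the circle in the ends of
  the vertical diameter, which meets the horizontal one in the center. Since only the
  arbitrary points vary between branches, the set of letters allowed at a position of a word does not
  depend on the preceding letters.\<close>

section \<open>Trees of words with prescribed letter sets\<close>

definition fits :: "'a set list \<Rightarrow> 'a list \<Rightarrow> bool" where
  "fits L u \<longleftrightarrow> length u \<le> length L \<and> (\<forall>i<length u. u ! i \<in> L ! i)"

text \<open>For an edge it is enough that the longer word fits, because prefixes of fitting words
  fit. The vertices have between 1 and \<open>length L + 1\<close> letters.\<close>

definition level_tree :: "'a \<Rightarrow> 'a set list \<Rightarrow> 'a list tree" where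
  "level_tree a L =
     \<lparr>tree_root = [a],
      verts = {u. u \<noteq> [] \<and> fits ({a} # L) u},
      edges = {(u, u @ [x]) | u x. u \<noteq> [] \<and> fits ({a} # L) (u @ [x])}\<rparr>"

lemma fits_snoc:
  "fits L (u @ [x]) \<longleftrightarrow> fits L u \<and> length u < length L \<and> x \<in> L ! length u"
  by (auto simp: fits_def nth_append less_Suc_eq)

lemma fits_take: "fits L u \<Longrightarrow> fits L (take n u)"
  by (auto simp: fits_def)

lemma fits_hd: "fits ({a} # L) u \<Longrightarrow> u \<noteq> [] \<Longrightarrow> hd u = a"
  by (auto simp: fits_def hd_conv_nth)

lemma children_level_tree:
  assumes "u \<in> verts (level_tree a L)"
  shows "children (level_tree a L) u =
    (if length u \<le> length L then (\<lambda>x. u @ [x]) ` (({a} # L) ! length u) else {})"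
  using assms by (auto simp: children_def level_tree_def fits_snoc)

text \<open>Each step appends one letter, so every word of the chain is a prefix of the last one and
  the lengths increase by one. First length and last word thus determine the whole chain, which
  gives uniqueness of walks from the root.\<close>

lemma snoc_chain_eq_map_take:
  assumes "successively (\<lambda>u v. \<exists>x. v = u @ [x]) p" "p \<noteq> []"
  shows "p = map (\<lambda>i. take i (last p)) [length (hd p)..<Suc (length (last p))]"
  using assms
proof (induction p rule: induct_list012)
  case (3 u v p)
  let ?q = "v # p"
  let ?w = "last ?q"
  obtain x where v: "v = u @ [x]"
    using 3 by auto
  have "successively (\<lambda>u v. \<exists>x. v = u @ [x]) ?q"
    using 3 by simp
  then have IH: "?q = map (\<lambda>i. take i ?w) [length v..<Suc (length ?w)]"
    using "3.IH"(2) by (simp only: list.sel list.distinct not_False_eq_True simp_thms)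
  have le: "length v \<le> length ?w"
    using arg_cong[OF IH, of length] by (simp split: if_splits del: last.simps upt_Suc)
  then have "take (length v) ?w = v"
    using arg_cong[OF IH, of hd] by (simp only: upt_conv_Cons le_imp_less_Suc list.map list.sel)
  \<comment> \<open>Being a prefix of \<open>v\<close>, which is a prefix of \<open>?w\<close>, also
    \<open>u\<close> is one; the list of prefixes extends by one at the front.\<close>
  then have "?w = u @ x # drop (length v) ?w"
    by (metis v append_take_drop_id append_Cons append_Nil append_assoc)
  then have u: "take (length u) ?w = u"
    by (metis append_eq_conv_conj)
  have "[length u..<Suc (length ?w)] = length u # [length v..<Suc (length ?w)]"
    using le v by (simp add: upt_conv_Cons del: upt_Suc)
  then have "map (\<lambda>i. take i ?w) [length u..<Suc (length ?w)] = u # ?q"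
    by (simp only: list.map u IH[symmetric])
  then show ?case
    by (simp only: list.sel last_ConsR list.distinct not_False_eq_True)
qed simp_all

lemma rooted_tree_level_tree: "rooted_tree (level_tree a L)"
  unfolding rooted_tree_def
proof (intro conjI ballI)
  let ?T = "level_tree a L"
  show "tree_root ?T \<in> verts ?T"
    by (simp add: level_tree_def fits_def)
  show "edges ?T \<subseteq> verts ?T \<times> verts ?T"
    by (auto simp: level_tree_def fits_snoc)
  fix u assume u: "u \<in> verts ?T"
  then have fits: "u \<noteq> []" "fits ({a} # L) u"
    by (auto simp: level_tree_def)
  have root: "take (Suc 0) u = [a]"
    using fits fits_hd[OF fits(2)] by (cases u) auto
  let ?p = "map (\<lambda>i. take i u) [1..<Suc (length u)]"
  show "\<exists>!p. walk ?T p \<and> hd p = tree_root ?T \<and> last p = u"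
  proof (rule ex1I[of _ ?p])
    have "(take i u, take (Suc i) u) \<in> edges ?T" if "1 \<le> i" "i < length u" for i
      using that fits fits_take[OF fits(2), of "Suc i"]
      by (auto simp: level_tree_def take_Suc_conv_app_nth)
    then have "successively (\<lambda>v w. (v, w) \<in> edges ?T) ?p"
      by (auto simp: successively_conv_nth simp del: upt_Suc)
    moreover have "set ?p \<subseteq> verts ?T"
      using fits by (auto simp: level_tree_def intro: fits_take)
    ultimately show "walk ?T ?p \<and> hd ?p = tree_root ?T \<and> last ?p = u"
      using root fits(1)
      by (simp add: walk_def hd_map last_map level_tree_def Suc_le_eq del: upt_Suc)
  next
    fix p assume p: "walk ?T p \<and> hd p = tree_root ?T \<and> last p = u"
    then have "successively (\<lambda>v w. \<exists>x. w = v @ [x]) p"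
      by (auto simp: walk_def level_tree_def elim!: successively_mono)
    from snoc_chain_eq_map_take[OF this] show "p = ?p"
      using p by (simp add: walk_def level_tree_def del: upt_Suc)
  qed
qed

text \<open>Words gain a letter along every edge, while only words of at most
  \<open>length L\<close> letters have children.\<close>

lemma terminating_level_tree: "terminating (level_tree a L)"
  unfolding terminating_def
proof
  assume "\<exists>f. infinite_branch (level_tree a L) f"
  then obtain f where edge: "(f n, f (Suc n)) \<in> edges (level_tree a L)" for n
    by (auto simp: infinite_branch_def)
  have "n \<le> length (f n)" for n
  proof (induction n)
    case (Suc n)
    then show ?case
      using edge[of n] by (auto simp: level_tree_def)
  qed simp
  moreover have "length (f n) \<le> length L" for n
    using edge[of n] by (auto simp: level_tree_def fits_snoc)
  ultimately show False
    by (meson not_less_eq_eq order_trans)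
qed

section \<open>Lines, circles and segments\<close>

lemma line_through_horizontal:
  assumes "x \<noteq> x'"
  shows "line_through (x, d) (x', d) = UNIV \<times> {d}"
proof -
  have "(y, d) \<in> line_through (x, d) (x', d)" for y
  proof -
    \<comment> \<open>The affine coordinate of \<open>y\<close> with value 0 at \<open>x\<close> and
      1 at \<open>x'\<close>.\<close>
    define t where "t = (y - x) / (x' - x)"
    then have "t * (x' - x) = y - x"
      using assms by simp
    then have "(y, d) = (1 - t) *\<^sub>R (x, d) + t *\<^sub>R (x', d)"
      by (simp add: algebra_simps)
    then show ?thesis
      unfolding line_through_def affine_hull_2 by (smt (verit) mem_Collect_eq)
  qed
  then show ?thesis
    \<comment> \<open>For the converse inclusion, coefficients of sum 1 keep the second coordinate:
      \<open>u * d + v * d = (u + v) * d = d\<close>, hence distributivity read backwards.\<close>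
    by (auto simp: line_through_def affine_hull_2 simp flip: distrib_right)
qed

lemma line_through_vertical:
  assumes "y \<noteq> y'"
  shows "line_through (d, y) (d, y') = {d} \<times> UNIV"
proof -
  have "(d, z) \<in> line_through (d, y) (d, y')" for z
  proof -
    define t where "t = (z - y) / (y' - y)"
    then have "t * (y' - y) = z - y"
      using assms by simp
    then have "(d, z) = (1 - t) *\<^sub>R (d, y) + t *\<^sub>R (d, y')"
      by (simp add: algebra_simps)
    then show ?thesis
      unfolding line_through_def affine_hull_2 by (smt (verit) mem_Collect_eq)
  qed
  then show ?thesis
    by (auto simp: line_through_def affine_hull_2 simp flip: distrib_right)
qed

lemma horizontal_in_lines: "UNIV \<times> {d} \<in> lines"
  using line_through_horizontal[of 0 1 d] by (force simp: lines_def)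

lemma vertical_in_lines: "{d} \<times> UNIV \<in> lines"
  using line_through_vertical[of 0 1 d] by (force simp: lines_def)

text \<open>A bounded affine set has at most one point. Boundedness is what separates lines from
  circles and from segments.\<close>

lemma not_bounded_line:
  assumes "X \<in> lines"
  shows "\<not> bounded X"
proof
  assume "bounded X"
  obtain a b where X: "X = affine hull {a, b}" "a \<noteq> b"
    using assms by (auto simp: lines_def line_through_def)
  then have "a \<in> X" "b \<in> X"
    by (auto intro: hull_inc)
  with X \<open>bounded X\<close> affine_bounded_eq_trivial[of X] show False
    by auto
qed

lemma line_not_circle: "X \<in> lines \<Longrightarrow> X \<notin> circles"
  using not_bounded_line bounded_sphere unfolding circles_def by blast

text \<open>Both sets are bounded, so heights are compared instead: the top and bottom points of a
  circle differ in height, the points of a horizontal segment do not.\<close>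

lemma circle_not_segment: "X \<in> circles \<Longrightarrow> X \<notin> horizontal_segments"
proof
  assume "X \<in> circles" "X \<in> horizontal_segments"
  then obtain p :: point and R a b d where "0 < R" and eq: "sphere p R = {a..b} \<times> {d}"
    unfolding circles_def horizontal_segments_def by blast
  have "p + (0, R) \<in> sphere p R" "p - (0, R) \<in> sphere p R"
    using \<open>0 < R\<close> by (simp_all add: dist_norm norm_Pair)
  then have "snd (p + (0, R)) = d" "snd (p - (0, R)) = d"
    unfolding eq by (simp_all only: mem_Times_iff singleton_iff)
  with \<open>0 < R\<close> show False
    by simp
qed

lemma bounded_segment: "X \<in> horizontal_segments \<Longrightarrow> bounded X"
  by (auto simp: horizontal_segments_def intro: bounded_Times)

lemma admissible_horizontal_segments: "admissible horizontal_segments"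
proof -
  have "{} \<notin> horizontal_segments"
    by (auto simp: horizontal_segments_def Times_empty eq_commute[of "{}"])
  then show ?thesis
    using not_bounded_line bounded_segment circle_not_segment unfolding admissible_def by blast
qed

section \<open>Construction of the center\<close>

text \<open>Singletons are forced letters; the sets at offsets 1 and 3 are the free picks. The
  segments do not depend on the circle, only on the height.\<close>

definition horizontal_line_moves :: "real \<Rightarrow> letter set list" where
  "horizontal_line_moves d =
     [{Fig ({0..1} \<times> {d})}, Pt ` ({0..1} \<times> {d}),
      {Fig ({2..3} \<times> {d})}, Pt ` ({2..3} \<times> {d}), {Fig (UNIV \<times> {d})}]"

text \<open>With the given circle at index 0, the blocks occupy 1-5, 6-10 and 11-15, so their lines
  stand at 5, 10 and 15. The tangent points are at 16 and 17, the vertical diameter line at 18, the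
  center at 19.\<close>

definition center_moves :: "real \<Rightarrow> real \<Rightarrow> real \<Rightarrow> letter set list" where
  "center_moves x y R =
     horizontal_line_moves y @ horizontal_line_moves (y + R) @ horizontal_line_moves (y - R) @
     [{Pt (x, y + R)}, {Pt (x, y - R)}, {Fig ({x} \<times> UNIV)}, {Pt (x, y)}]"

text \<open>The block starts at index \<open>m\<close>, and \<open>n\<close> of its letters are
  already written. The condition on \<open>u ! (m - 1)\<close> makes \<open>u\<close> deterministic
  when \<open>n = 0\<close>, as rule 5 demands.\<close>

lemma ec_rule_horizontal_line_moves:
  assumes "0 < m" "u ! (m - 1) \<notin> Fig ` horizontal_segments"
    and u: "\<And>l. l < n \<Longrightarrow> u ! (m + l) \<in> horizontal_line_moves d ! l"
    and n: "length u = m + n" "n < 5"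
  shows "ec_rule horizontal_segments u ((\<lambda>z. u @ [z]) ` (horizontal_line_moves d ! n))"
proof -
  let ?S = horizontal_segments
  have segment: "{a..b} \<times> {d} \<in> ?S" if "a < b" for a b
    using that by (auto simp: horizontal_segments_def)
  have last: "u \<noteq> []" "last u = u ! (m + n - 1)"
    using n \<open>0 < m\<close> last_conv_nth[of u] by fastforce+
  have pick: "ec_rule ?S u ((\<lambda>z. u @ [z]) ` Pt ` X)" if "last u = Fig X" "X \<in> ?S" for X
    using rule6[OF last(1) that] by (simp only: image_image Setcompr_eq_image)
  have "n = 0 \<or> n = 1 \<or> n = 2 \<or> n = 3 \<or> n = 4"
    using n by arith
  then show ?thesis
  proof (elim disjE)
    assume "n = 0"
    then have "deterministic ?S u"
      using assms last by (simp add: deterministic_def)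
    from rule5[OF this segment[of 0 1]] show ?thesis
      using \<open>n = 0\<close> by (simp add: horizontal_line_moves_def)
  next
    assume "n = 1"
    then show ?thesis
      using pick[OF _ segment[of 0 1]] u[of 0] last by (simp add: horizontal_line_moves_def)
  next
    assume "n = 2"
    then have "deterministic ?S u"
      using u[of 1] last by (auto simp: deterministic_def horizontal_line_moves_def)
    from rule5[OF this segment[of 2 3]] show ?thesis
      using \<open>n = 2\<close> by (simp add: horizontal_line_moves_def)
  next
    assume "n = 3"
    then show ?thesis
      using pick[OF _ segment[of 2 3]] u[of 2] last
      by (simp add: horizontal_line_moves_def numeral_3_eq_3)
  next
    assume "n = 4"
    \<comment> \<open>The picks satisfy \<open>a\<close> \<le> 1 < 2 \<le> \<open>b\<close>, so rule
      2 applies on every branch and always draws the same line.\<close>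
    then obtain a b where ab: "u ! (m + 1) = Pt (a, d)" "u ! (m + 3) = Pt (b, d)" "a \<noteq> b"
      using u[of 1] u[of 3] by (force simp: horizontal_line_moves_def)
    moreover have "deterministic ?S u"
      using \<open>n = 4\<close> ab last by (auto simp: deterministic_def eval_nat_numeral)
    ultimately show ?thesis
      using \<open>n = 4\<close> n rule2[of ?S u "m + 1" "m + 3" "(a, d)" "(b, d)"]
      by (simp add: horizontal_line_moves_def line_through_horizontal)
  qed
qed

text \<open>The length of \<open>u\<close> decides the rule: the previous lemma within the three
  blocks, then rule 4 for each tangent point, rule 2 for the vertical line and rule 4 for the
  center.\<close>

lemma ec_rule_center_moves:
  assumes "0 < R"
    and fits: "fits ({Fig (sphere (x, y) R)} # center_moves x y R) u" (is "fits ?L u")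
    and "u \<noteq> []" "length u \<le> length (center_moves x y R)"
  shows "ec_rule horizontal_segments u ((\<lambda>z. u @ [z]) ` (?L ! length u))"
proof -
  let ?S = horizontal_segments and ?k = "sphere (x, y) R"
  have length_moves: "length (horizontal_line_moves d) = 5" for d
    by (simp add: horizontal_line_moves_def)
  have nth: "u ! i \<in> ?L ! i" if "i < length u" for i
    using fits that by (simp add: fits_def)
  have L_0: "?L ! 0 = {Fig ?k}"
    by simp
  have L_block:
    "?L ! (1 + l) = horizontal_line_moves y ! l"
    "?L ! (6 + l) = horizontal_line_moves (y + R) ! l"
    "?L ! (11 + l) = horizontal_line_moves (y - R) ! l" if "l < 5" for l
    using that by (simp_all add: center_moves_def nth_append length_moves nth_Cons')
  have L_line: "?L ! 5 = {Fig (UNIV \<times> {y})}" "?L ! 10 = {Fig (UNIV \<times> {y + R})}"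
    "?L ! 15 = {Fig (UNIV \<times> {y - R})}"
    using L_block[of 4] by (simp_all add: horizontal_line_moves_def)
  have L_end: "?L ! 16 = {Pt (x, y + R)}" "?L ! 17 = {Pt (x, y - R)}"
    "?L ! 18 = {Fig ({x} \<times> UNIV)}" "?L ! 19 = {Pt (x, y)}"
    by (simp_all add: center_moves_def horizontal_line_moves_def)
  have k: "?k \<in> circles"
    using \<open>0 < R\<close> unfolding circles_def by blast
  have line: "X \<notin> ?S" if "X \<in> lines" for X
    using that bounded_segment not_bounded_line by blast
  have no_pick: "Fig X \<notin> Fig ` ?S" if "X \<in> lines \<union> circles" for X
    using that line circle_not_segment by auto
  \<comment> \<open>The letter before each block is the given circle or the line closing the
    previous block, hence never a segment.\<close>
  have block: ?thesis
    if "m \<le> length u" "length u < m + 5" "0 < m" "u ! (m - 1) \<notin> Fig ` ?S"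
      and L: "\<And>l. l < 5 \<Longrightarrow> ?L ! (m + l) = horizontal_line_moves d ! l" for m d
  proof -
    obtain n where n: "length u = m + n" "n < 5"
      using \<open>m \<le> length u\<close> \<open>length u < m + 5\<close> by (auto simp: le_iff_add)
    have "u ! (m + l) \<in> horizontal_line_moves d ! l" if "l < n" for l
      using nth[of "m + l"] L[of l] n that by simp
    from ec_rule_horizontal_line_moves[OF that(3,4) this n] show ?thesis
      using L[OF n(2)] n(1) by simp
  qed
  have deterministic: "deterministic ?S u" if "u ! (length u - 1) \<notin> Fig ` ?S"
    using that \<open>u \<noteq> []\<close> by (simp add: deterministic_def last_conv_nth)
  have tangent: "(x, y + R) \<in> ?k" "(x, y - R) \<in> ?k"
    using \<open>0 < R\<close> by (auto simp: dist_Pair_Pair dist_real_def)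
  have tangent_line: "?k \<noteq> UNIV \<times> {d}" for d
    using k line_not_circle[OF horizontal_in_lines[of d]] by metis
  have u_line: "u ! 0 = Fig ?k" "5 < length u \<Longrightarrow> u ! 5 = Fig (UNIV \<times> {y})"
      "10 < length u \<Longrightarrow> u ! 10 = Fig (UNIV \<times> {y + R})"
      "15 < length u \<Longrightarrow> u ! 15 = Fig (UNIV \<times> {y - R})"
      "16 < length u \<Longrightarrow> u ! 16 = Pt (x, y + R)"
      "17 < length u \<Longrightarrow> u ! 17 = Pt (x, y - R)"
      "18 < length u \<Longrightarrow> u ! 18 = Fig ({x} \<times> UNIV)"
    using nth[of 0] nth[of 5] nth[of 10] nth[of 15] nth[of 16] nth[of 17] nth[of 18] \<open>u \<noteq> []\<close>
    unfolding L_0 L_line L_end by auto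
  have meet: "ec_rule ?S u ((\<lambda>z. u @ [z]) ` {Pt a})"
    if "i < j" "j < length u" "u ! i = Fig X" "u ! j = Fig Y" "X \<noteq> Y"
      "X \<in> lines \<union> circles" "Y \<in> lines \<union> circles" "a \<in> X \<inter> Y"
      "u ! (length u - 1) \<notin> Fig ` ?S" for i j X Y a
    using rule4[OF deterministic[OF that(9)] that(1-4,6,7,5,8)] by simp
  have "0 < length u" "length u < 20"
    using assms(3,4) by (auto simp: center_moves_def length_moves)
  then consider "1 \<le> length u \<and> length u < 1 + 5" | "6 \<le> length u \<and> length u < 6 + 5"
    | "11 \<le> length u \<and> length u < 11 + 5" | "length u = 16" | "length u = 17" | "length u = 18"
    | "length u = 19"
    by linarith
  then show ?thesis
  proof cases
    case 1
    then show ?thesis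
      using block[of 1 y] L_block(1) no_pick k u_line by simp
  next
    case 2
    then show ?thesis
      using block[of 6 "y + R"] L_block(2) no_pick horizontal_in_lines u_line by simp
  next
    case 3
    then show ?thesis
      using block[of 11 "y - R"] L_block(3) no_pick horizontal_in_lines u_line by simp
  next
    case 4
    then show ?thesis
      using meet[of 0 10 ?k "UNIV \<times> {y + R}" "(x, y + R)"] u_line tangent(1) k tangent_line
        horizontal_in_lines no_pick
      unfolding L_end 4 by auto
  next
    case 5
    then show ?thesis
      using meet[of 0 15 ?k "UNIV \<times> {y - R}" "(x, y - R)"] u_line tangent(2) k tangent_line
        horizontal_in_lines
      unfolding L_end 5 by auto
  next
    case 6
    then have "deterministic ?S u"
      using u_line deterministic by auto
    \<comment> \<open>The tangent points differ in height by \<open>2 * R > 0\<close>, so they span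
      the vertical line through the center.\<close>
    from rule2[OF this, of 16 17 "(x, y + R)" "(x, y - R)"] show ?thesis
      using u_line \<open>0 < R\<close> unfolding L_end 6 by (simp add: line_through_vertical)
  next
    case 7
    have "(UNIV :: real set) \<times> {y} \<noteq> {x} \<times> (UNIV :: real set)"
      by (metis UNIV_I mem_Sigma_iff singletonD singletonI zero_neq_one)
    then show ?thesis
      using meet[of 5 18 "UNIV \<times> {y}" "{x} \<times> UNIV" "(x, y)"] u_line horizontal_in_lines
        vertical_in_lines no_pick unfolding L_end 7 by auto
  qed
qed

text \<open>Serves twice: all vertices are words over the required alphabet, and no circle is ever
  appended, which makes the construction a straightedge one.\<close>

lemma center_moves_letters:
  assumes "z \<in> A" "A \<in> set (center_moves x y R)"
  shows "z \<in> range Pt \<union> Fig ` (lines \<union> horizontal_segments)"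
proof -
  have "{0..1} \<times> {d} \<in> horizontal_segments" "{2..3} \<times> {d} \<in> horizontal_segments" for d
    unfolding horizontal_segments_def by fastforce+
  with assms show ?thesis
    using horizontal_in_lines vertical_in_lines
    by (auto simp: center_moves_def horizontal_line_moves_def)
qed

theorem proposition2p9:
  fixes k :: "point set" and c :: point and R :: real
  assumes "0 < R" and "k = sphere c R"
  shows "\<exists>T. EC horizontal_segments T \<and> straightedge T \<and>
             constructs horizontal_segments T {[Pt c]} [Fig k]"
proof -
  obtain x y where c: "c = (x, y)"
    by fastforce
  let ?S = horizontal_segments and ?M = "center_moves x y R"
  let ?T = "level_tree (Fig k) ?M"
  have k: "k \<in> circles"
    using assms unfolding circles_def by blast
  have length_M: "length ?M = 19"
    by (simp add: center_moves_def horizontal_line_moves_def)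
  have verts: "u \<noteq> []" "fits ({Fig k} # ?M) u" if "u \<in> verts ?T" for u
    using that by (auto simp: level_tree_def)
  have letters: "z = Fig k \<or> z \<in> range Pt \<union> Fig ` (lines \<union> ?S)"
    if u: "u \<in> verts ?T" and z: "z \<in> set u" for u z
  proof -
    obtain i where "i < length u" "u ! i = z"
      using z unfolding in_set_conv_nth by blast
    with verts[OF u] have "z \<in> ({Fig k} # ?M) ! i" "i < Suc (length ?M)"
      by (auto simp: fits_def)
    then show ?thesis
      using center_moves_letters[of z "?M ! (i - 1)" x y R] by (cases i) auto
  qed
  have last: "u ! 19 = Pt c" if "u \<in> verts ?T" "19 < length u" for u
    using verts[OF that(1)] that(2) c
    by (auto simp: fits_def center_moves_def horizontal_line_moves_def dest!: spec[of _ 19])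
  have rule: "ec_rule ?S u (children ?T u)" if u: "u \<in> verts ?T" for u
  proof (cases "length u \<le> length ?M")
    case True
    then show ?thesis
      using u ec_rule_center_moves[of R x y u] verts[OF u] assms c
      by (simp add: children_level_tree)
  next
    case False
    \<comment> \<open>A full word ends in the point \<open>c\<close>; it is therefore deterministic
      and may be a leaf by rule 1.\<close>
    then have "length u = 20"
      using verts[OF u] length_M by (simp add: fits_def)
    then have "deterministic ?S u"
      using last[OF u] verts[OF u] by (auto simp: deterministic_def last_conv_nth)
    with False u show ?thesis
      by (simp add: children_level_tree rule1)
  qed
  have EC: "EC ?S ?T"
    unfolding EC_def
  proof (intro conjI ballI)
    show "verts ?T \<subseteq> lists (plc \<union> Fig ` ?S)"
      using letters k by (force simp: plc_def)
    show "tree_root ?T \<in> lists plc"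
      using k by (simp add: level_tree_def plc_def)
  qed (use rule in \<open>simp_all add: admissible_horizontal_segments rooted_tree_level_tree\<close>)
  have "straightedge ?T"
    unfolding straightedge_def
  proof (intro notI, elim exE conjE, hypsubst)
    fix u a b e
    assume edge: "(u, u @ [compass a b e]) \<in> edges ?T" and "b \<noteq> e"
    then have circle: "compass a b e = Fig (sphere a (dist b e))" "sphere a (dist b e) \<in> circles"
      unfolding compass_def circles_def by (simp, use \<open>b \<noteq> e\<close> zero_less_dist_iff in blast)
    from edge have "u \<noteq> []" "fits ({Fig k} # ?M) (u @ [compass a b e])"
      by (simp_all add: level_tree_def)
    \<comment> \<open>As \<open>u\<close> is nonempty, the appended letter is not the given circle
      at index 0 but comes from \<open>?M\<close>, where no circle occurs.\<close>
    then obtain n where "n < length ?M" "compass a b e \<in> ?M ! n"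
      by (cases "length u") (auto simp: fits_snoc)
    from center_moves_letters[OF this(2) nth_mem[OF this(1)]] show False
      using circle line_not_circle circle_not_segment by auto
  qed
  moreover have "constructs ?S ?T {[Pt c]} [Fig k]"
    unfolding constructs_def
  proof (intro conjI allI impI)
    fix u assume "leaf ?T u"
    then have u: "u \<in> verts ?T" "children ?T u = {}"
      by (auto simp: leaf_def)
    \<comment> \<open>Since every letter set is nonempty, each shorter word has a child, and so
      leaves have full length 20.\<close>
    have "A \<noteq> {}" if "A \<in> set ?M" for A
      using that by (auto simp: center_moves_def horizontal_line_moves_def)
    then have "({Fig k} # ?M) ! length u \<noteq> {}" if "length u \<le> length ?M"
      using that verts[OF u(1)] by (cases "length u") auto
    with u have "length u = 20"
      using verts[OF u(1)] length_M
      by (auto simp: children_level_tree fits_def split: if_splits)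
    then have "drop 19 u = [Pt c]"
      using last[OF u(1)] Cons_nth_drop_Suc[of 19 u] by simp
    with \<open>length u = 20\<close> show "\<exists>j<length u. drop j u \<in> {[Pt c]}"
      by (intro exI[of _ 19]) simp
  qed (use EC in \<open>simp_all add: plc_def terminating_level_tree\<close>, simp add: level_tree_def)
  ultimately show ?thesis
    using EC by blast
qed

end
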